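(* Let $X$ be a Fréchet space, $Y$ a separable Fréchet space and $T_n:X\to Y$, $n\in\mathbb{N}$, continuous linear mappings. Suppose that there are a dense subset $Y_0$ of $Y$ and mappings $S_n:Y_0\to X$, $n\in\mathbb{N}$, such that: (1) $\sum_{n=1}^{k-1}T_kS_{k-n}y$ converges unconditionally in $Y$, uniformly in $k\in\mathbb{N}$, for all $y\in Y_0$; (2) $\sum_{n=1}^{+\infty}T_kS_{k+n}y$ converges unconditionally in $Y$, uniformly in $k\in\mathbb{N}$, for all $y\in Y_0$; (3) $\sum_{n=1}^{+\infty}S_ny$ converges unconditionally in $X$, for all $y\in Y_0$; (4) $T_nS_ny\to y$ as $n\to+\infty$, for all $y\in Y_0$. Then for every integer $s\geq 1$ the sequence $(T_n)$ is $\tilde D_s$-frequently universal.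
   Context: $\mathbb{N}$ denotes the set of positive integers. Given a non-negative sequence $(\alpha_k)_{k\ge1}$ with $\sum_k\alpha_k=+\infty$, the associated admissible matrix is $A=(\alpha_{n,k})$ with $\alpha_{n,k}=\alpha_k/\sum_{j=1}^n\alpha_j$ for $1\le k\le n$ and $\alpha_{n,k}=0$ for $k>n$. The lower $A$-density of $E\subset\mathbb{N}$ is $\underline{d}_A(E)=\liminf_{n\to\infty}\sum_{k=1}^{+\infty}\alpha_{n,k}\mathbf{1}_E(k)$. A sequence $(T_n)$ of continuous linear maps $T_n:X\to Y$ is $A$-frequently universal if there exists $x\in X$ such that for every non-empty open set $U\subset Y$ the set $N(x,U)=\{n\in\mathbb{N}:T_nx\in U\}$ satisfies $\underline{d}_A(N(x,U))>0$. For $s\ge1$, $\log^{(s)}=\log\circ\cdots\circ\log$ ($s$ times), and $\tilde D_s$ is the admissible matrix given by the coefficients $\alpha_k=e^{k/\log^{(s)}(k)}$ for $k$ large enough (the finitely many remaining coefficients are arbitrary positive numbers and do not affect the density). Unconditional convergence uniformly in $k$: series $\sum_n y_{n,k}$ ($k\in\mathbb{N}$; terms not present in a finite sum are taken to be $0$) converge unconditionally in $Y$, uniformly in $k\in\mathbb{N}$, if for each $k$ the series converges unconditionally and for every neighbourhood $W$ of $0$ in $Y$ there is $N\ge1$ such that $\sum_{n\in F}y_{n,k}\in W$ for every $k\in\mathbb{N}$ and every finite set $F\subset\{N,N+1,\dots\}$. *)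

theory Defs
  imports "HOL-Analysis.Analysis"
begin

section \<open>Frechet spaces\<close>

definition (in real_vector) seminorm :: "('a \<Rightarrow> real) \<Rightarrow> bool" where
  "seminorm p \<longleftrightarrow>
     (\<forall>x y. p (x + y) \<le> p x + p y) \<and> (\<forall>c x. p (scaleR c x) = \<bar>c\<bar> * p x)"

text \<open>
  The topology is the one induced by a separating sequence of seminorms, with respect to
  which the space is sequentially complete. Complex Frechet spaces are included by restriction
  of scalars.
\<close>

class frechet_space = real_vector + topological_space +
  assumes frechet_seminorms:
    "\<exists>p :: nat \<Rightarrow> 'a \<Rightarrow> real.
       (\<forall>n. seminorm (p n)) \<and>
       (\<forall>x. (\<forall>n. p n x = 0) \<longrightarrow> x = 0) \<and>
       (\<forall>U. open U \<longleftrightarrow>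
          (\<forall>x\<in>U. \<exists>N. \<exists>\<epsilon>>0. \<forall>y. (\<forall>n\<le>N. p n (y - x) < \<epsilon>) \<longrightarrow> y \<in> U)) \<and>
       (\<forall>u :: nat \<Rightarrow> 'a.
          (\<forall>n. \<forall>\<epsilon>>0. \<exists>M. \<forall>i\<ge>M. \<forall>j\<ge>M. p n (u i - u j) < \<epsilon>) \<longrightarrow>
          (\<exists>l. \<forall>n. (\<lambda>i. p n (u i - l)) \<longlonglongrightarrow> 0))"

instance banach \<subseteq> frechet_space
proof
  let ?p = "\<lambda>_::nat. norm :: 'a \<Rightarrow> real"
  have "seminorm (norm :: 'a \<Rightarrow> real)"
    by (simp add: seminorm_def norm_triangle_ineq)
  moreover have "open U \<longleftrightarrow>
      (\<forall>x\<in>U. \<exists>N. \<exists>\<epsilon>>0. \<forall>y. (\<forall>n\<le>N. ?p n (y - x) < \<epsilon>) \<longrightarrow> y \<in> U)" for U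
    by (simp add: open_dist dist_norm exI[of "\<lambda>n. n \<le> _" 0])
  moreover have "\<exists>l. (\<lambda>i. norm (u i - l)) \<longlonglongrightarrow> 0"
    if u: "\<forall>\<epsilon>>0. \<exists>M. \<forall>i\<ge>M. \<forall>j\<ge>M. norm (u i - u j) < \<epsilon>" for u :: "nat \<Rightarrow> 'a"
  proof -
    have "Cauchy u"
      using u by (simp add: Cauchy_def dist_norm)
    then obtain l where "u \<longlonglongrightarrow> l"
      using Cauchy_convergent convergent_def by blast
    then show ?thesis
      using LIM_zero tendsto_norm_zero by blast
  qed
  ultimately show "\<exists>p :: nat \<Rightarrow> 'a \<Rightarrow> real.
       (\<forall>n. seminorm (p n)) \<and>
       (\<forall>x. (\<forall>n. p n x = 0) \<longrightarrow> x = 0) \<and>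
       (\<forall>U. open U \<longleftrightarrow>
          (\<forall>x\<in>U. \<exists>N. \<exists>\<epsilon>>0. \<forall>y. (\<forall>n\<le>N. p n (y - x) < \<epsilon>) \<longrightarrow> y \<in> U)) \<and>
       (\<forall>u :: nat \<Rightarrow> 'a.
          (\<forall>n. \<forall>\<epsilon>>0. \<exists>M. \<forall>i\<ge>M. \<forall>j\<ge>M. p n (u i - u j) < \<epsilon>) \<longrightarrow>
          (\<exists>l. \<forall>n. (\<lambda>i. p n (u i - l)) \<longlonglongrightarrow> 0))"
    by (intro exI[of _ ?p] conjI allI) simp_all
qed

section \<open>Unconditional convergence, uniformly in a parameter\<close>

text \<open>
  The positive integers are the set \<open>{1..}\<close> of naturals, so values at index \<open>0\<close> are irrelevant
  below. Unconditional convergence of a single series is \<open>summable_on\<close>; the series with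
  parameter \<open>k\<close> has terms \<open>y k n\<close>, \<open>n \<ge> 1\<close>.
\<close>

definition uniformly_unconditionally_summable ::
    "(nat \<Rightarrow> nat \<Rightarrow> 'a::{comm_monoid_add, topological_space}) \<Rightarrow> bool" where
  "uniformly_unconditionally_summable y \<longleftrightarrow>
     (\<forall>k\<ge>1. y k summable_on {1..}) \<and>
     (\<forall>W. 0 \<in> interior W \<longrightarrow>
        (\<exists>N\<ge>1. \<forall>k\<ge>1. \<forall>F. finite F \<and> F \<subseteq> {N..} \<longrightarrow> (\<Sum>n\<in>F. y k n) \<in> W))"

section \<open>Weighted densities and frequent universality\<close>

definition admissible_weights :: "(nat \<Rightarrow> real) \<Rightarrow> bool" where
  "admissible_weights \<alpha> \<longleftrightarrow>
     (\<forall>k\<ge>1. 0 \<le> \<alpha> k) \<and> filterlim (\<lambda>n. \<Sum>k=1..n. \<alpha> k) at_top sequentially"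

definition weight_matrix :: "(nat \<Rightarrow> real) \<Rightarrow> nat \<Rightarrow> nat \<Rightarrow> real" where
  "weight_matrix \<alpha> n k = (if 1 \<le> k \<and> k \<le> n then \<alpha> k / (\<Sum>j=1..n. \<alpha> j) else 0)"

definition lower_density :: "(nat \<Rightarrow> nat \<Rightarrow> real) \<Rightarrow> nat set \<Rightarrow> ereal" where
  "lower_density A E = liminf (\<lambda>n. ereal (\<Sum>\<^sub>\<infinity>k\<in>{1..}. A n k * indicator E k))"

definition frequently_universal ::
    "(nat \<Rightarrow> nat \<Rightarrow> real) \<Rightarrow> (nat \<Rightarrow> 'a \<Rightarrow> 'b::topological_space) \<Rightarrow> bool" where
  "frequently_universal A T \<longleftrightarrow>
     (\<exists>x. \<forall>U. open U \<and> U \<noteq> {} \<longrightarrow> 0 < lower_density A {n. 1 \<le> n \<and> T n x \<in> U})"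

text \<open>
  The weights defining \<open>D\<^sub>s\<close>-tilde are prescribed only from some index on, where the iterated
  logarithm is positive; the finitely many others are arbitrary positive numbers.
\<close>

definition D_tilde_weights :: "nat \<Rightarrow> (nat \<Rightarrow> real) \<Rightarrow> bool" where
  "D_tilde_weights s \<alpha> \<longleftrightarrow>
     (\<forall>k\<ge>1. 0 < \<alpha> k) \<and>
     (\<forall>\<^sub>F k in sequentially. \<alpha> k = exp (real k / (ln ^^ s) (real k)))"

lemma filterlim_iterated_ln: "filterlim ((ln :: real \<Rightarrow> real) ^^ s) at_top at_top"
proof (induction s)
  case 0
  show ?case
    by (simp add: id_def filterlim_ident)
next
  case (Suc s)
  then show ?case
    by (simp add: o_def filterlim_compose[OF ln_at_top])
qed

lemma D_tilde_weights_admissible: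
  assumes "D_tilde_weights s \<alpha>"
  shows "admissible_weights \<alpha>"
proof -
  have "filterlim (\<lambda>k. (ln ^^ s) (real k)) at_top sequentially"
    by (rule filterlim_compose[OF filterlim_iterated_ln filterlim_real_sequentially])
  then have "\<forall>\<^sub>F k in sequentially. 0 < (ln ^^ s) (real k)"
    by (simp add: filterlim_at_top_dense)
  moreover have "\<forall>\<^sub>F k in sequentially. \<alpha> k = exp (real k / (ln ^^ s) (real k))"
    using assms by (simp add: D_tilde_weights_def)
  ultimately have "\<forall>\<^sub>F k in sequentially. 1 \<le> \<alpha> k"
    by eventually_elim simp
  then obtain M where M: "\<And>k. M \<le> k \<Longrightarrow> 1 \<le> \<alpha> k"
    by (auto simp: eventually_sequentially)
  have pos: "\<And>k. 1 \<le> k \<Longrightarrow> 0 < \<alpha> k"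
    using assms by (simp add: D_tilde_weights_def)
  have "real n - real M \<le> (\<Sum>k=1..n. \<alpha> k)" for n
  proof -
    have "real n - real M \<le> (\<Sum>k\<in>{M<..n}. 1)"
      by simp
    also have "\<dots> \<le> (\<Sum>k\<in>{M<..n}. \<alpha> k)"
      using M by (intro sum_mono) simp
    also have "\<dots> \<le> (\<Sum>k=1..n. \<alpha> k)"
      using pos by (intro sum_mono2) (auto intro: less_imp_le)
    finally show ?thesis .
  qed
  moreover have "filterlim (\<lambda>n. real n - real M) at_top sequentially"
    using filterlim_tendsto_add_at_top[OF tendsto_const[of "- real M"] filterlim_real_sequentially]
    by simp
  ultimately have "filterlim (\<lambda>n. \<Sum>k=1..n. \<alpha> k) at_top sequentially"
    by (auto intro: filterlim_at_top_mono)
  then show ?thesis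
    using pos by (auto simp: admissible_weights_def intro: less_imp_le)
qed

end

theory Submission
  imports Defs
begin

text \<open>
  All that matters about the weights \<open>\<alpha>\<^sub>k = exp (k / log\<^sup>(\<^sup>s\<^sup>) k)\<close> is that their sum diverges and
  that \<open>\<alpha>\<^sub>k\<^sub>+\<^sub>1 / \<alpha>\<^sub>k \<rightarrow> 1\<close>: for every such sequence the criterion gives frequent universality.

  Fix a sequence \<open>y\<^sub>0, y\<^sub>1, \<dots>\<close> in \<open>Y\<^sub>0\<close> every tail of which is dense in \<open>Y\<close>. The universal vector is
  \<open>x = \<Sum>\<^sub>r \<Sum>\<^sub>m\<^sub>\<in>\<^sub>E\<^sub>r S\<^sub>m y\<^sub>r\<close>, where the sets \<open>E\<^sub>r\<close> have positive lower density and any two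
  distinct elements \<open>k \<in> E\<^sub>p\<close>, \<open>m \<in> E\<^sub>r\<close> are at distance at least \<open>N\<^sub>M\<close>, \<open>M = max p r\<close>. If \<open>N\<close> grows fast
  enough, the summability hypotheses make \<open>x\<close> converge and, for \<open>k \<in> E\<^sub>p\<close>, make the sum of all terms
  \<open>T\<^sub>k S\<^sub>m y\<^sub>r\<close>, \<open>m \<noteq> k\<close>, of order \<open>2\<^sup>-\<^sup>p\<close>. The remaining term \<open>T\<^sub>k S\<^sub>k y\<^sub>p\<close> is close to \<open>y\<^sub>p\<close>, so the
  orbit is within \<open>O(2\<^sup>-\<^sup>p)\<close> of \<open>y\<^sub>p\<close> along the whole of \<open>E\<^sub>p\<close>. A given open set contains a
  neighbourhood of some \<open>y\<^sub>p\<close> with \<open>p\<close> as large as desired, hence is visited along some \<open>E\<^sub>p\<close>.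

  The sets \<open>E\<^sub>p\<close> come from \<open>separated_sets_of_positive_lower_density\<close>. They cannot have bounded gaps,
  because the separation distances are unbounded, but gaps growing arbitrarily slowly are possible.
  Take the multiples of \<open>g\<^sub>p\<close> from some index on and delete those that are too close to late multiples
  of some \<open>g\<^sub>q\<close>, \<open>q > p\<close>. As \<open>\<alpha>\<^sub>k\<^sub>+\<^sub>1 / \<alpha>\<^sub>k \<rightarrow> 1\<close>, the weights change by at most a factor 2 over \<open>g\<^sub>q\<close>
  consecutive late indices. Residue classes modulo \<open>g\<^sub>q\<close> therefore have weight of order \<open>1 / g\<^sub>q\<close>, and if
  \<open>g\<^sub>q\<close> grows fast the deleted parts together weigh less than the progression itself.
\<close>

section \<open>Weights that change slowly\<close>

lemma sum_Union_le:
  fixes f :: "'i \<Rightarrow> real"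
  assumes "finite I" and "\<And>i. i \<in> I \<Longrightarrow> finite (B i)"
    and "\<And>i k. i \<in> I \<Longrightarrow> k \<in> B i \<Longrightarrow> 0 \<le> f k"
  shows "sum f (\<Union>i\<in>I. B i) \<le> (\<Sum>i\<in>I. sum f (B i))"
proof -
  have "(\<Union>i\<in>I. B i) = snd ` Sigma I B"
    by force
  also have "sum f \<dots> \<le> sum (f \<circ> snd) (Sigma I B)"
    using assms by (intro sum_image_le) auto
  also have "\<dots> = (\<Sum>i\<in>I. sum f (B i))"
    using assms by (subst sum.Sigma) (auto simp: split_def)
  finally show ?thesis .
qed

lemma eventually_at_most_doubles_on_windows:
  fixes \<alpha> :: "nat \<Rightarrow> real"
  assumes pos: "\<And>k. 1 \<le> k \<Longrightarrow> 0 < \<alpha> k"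
    and ratio: "(\<lambda>k. \<alpha> (Suc k) / \<alpha> k) \<longlonglongrightarrow> 1"
  shows "\<forall>\<^sub>F k in sequentially. \<forall>i\<in>{..g}. \<alpha> (k + i) \<le> 2 * \<alpha> k"
proof (intro eventually_ball_finite ballI)
  fix i
  have lim: "(\<lambda>k. \<alpha> (k + i) / \<alpha> k) \<longlonglongrightarrow> 1"
  proof (induction i)
    case 0
    have "\<forall>\<^sub>F k in sequentially. \<alpha> (k + 0) / \<alpha> k = 1"
      using eventually_ge_at_top[of 1] by eventually_elim (use pos in force)
    then show ?case
      by (rule tendsto_eventually)
  next
    case (Suc i)
    have "(\<lambda>k. \<alpha> (Suc (k + i)) / \<alpha> (k + i)) \<longlonglongrightarrow> 1"
      by (rule LIMSEQ_ignore_initial_segment[OF ratio])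
    from tendsto_mult[OF this Suc]
    have "(\<lambda>k. \<alpha> (Suc (k + i)) / \<alpha> (k + i) * (\<alpha> (k + i) / \<alpha> k)) \<longlonglongrightarrow> 1"
      by simp
    moreover have "\<forall>\<^sub>F k in sequentially.
        \<alpha> (Suc (k + i)) / \<alpha> (k + i) * (\<alpha> (k + i) / \<alpha> k) = \<alpha> (k + Suc i) / \<alpha> k"
      using eventually_ge_at_top[of 1]
    proof eventually_elim
      case (elim k)
      then have "\<alpha> (k + i) \<noteq> 0"
        using pos[of "k + i"] by simp
      then show ?case by simp
    qed
    ultimately show ?case
      by (rule Lim_transform_eventually)
  qed
  have "\<forall>\<^sub>F k in sequentially. \<alpha> (k + i) / \<alpha> k < 2"
    by (rule order_tendstoD(2)[OF lim]) simp
  then show "\<forall>\<^sub>F k in sequentially. \<alpha> (k + i) \<le> 2 * \<alpha> k"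
    using eventually_ge_at_top[of 1]
  proof eventually_elim
    case (elim k)
    then show ?case
      using pos[of k] by (simp add: field_simps)
  qed
qed simp

text \<open>
  Each element \<open>k\<close> of the class weighs at most twice any of the indices \<open>k, k - 1, \<dots>, k - (g - 1)\<close>, and
  these blocks are disjoint for different elements of the class. The shift \<open>a\<close> is there to let
  a residue be taken of a difference that would be negative otherwise.
\<close>

lemma residue_class_weight_le:
  fixes \<alpha> :: "nat \<Rightarrow> real"
  assumes pos: "\<And>k. 1 \<le> k \<Longrightarrow> 0 \<le> \<alpha> k" and "1 \<le> K"
    and window: "\<And>k i. K \<le> k \<Longrightarrow> i \<le> g \<Longrightarrow> \<alpha> (k + i) \<le> 2 * \<alpha> k"
  shows "real g * sum \<alpha> {k \<in> {K + g..n}. (k + a) mod g = d} \<le> 2 * (\<Sum>k=1..n. \<alpha> k)"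
proof -
  define C where "C = {k \<in> {K + g..n}. (k + a) mod g = d}"
  have inj: "inj_on (\<lambda>(k, i). k - i) (C \<times> {..<g})"
  proof (rule inj_onI)
    fix x y
    assume "x \<in> C \<times> {..<g}" "y \<in> C \<times> {..<g}"
      and eq_xy: "(\<lambda>(k, i). k - i) x = (\<lambda>(k, i). k - i) y"
    then obtain k i k' i' where xy: "x = (k, i)" "y = (k', i')"
      and mem: "k \<in> C" "k' \<in> C" "i < g" "i' < g"
      by auto
    have diff: "k - i = k' - i'"
      using eq_xy by (simp add: xy)
    have eq: "u = u' \<and> j = j'"
      if "u \<in> C" "u' \<in> C" "j < g" "j' < g" "u - j = u' - j'" "j \<le> j'" for u u' j j'
    proof -
      have "u' + a = u + a + (j' - j)"
        using that by (auto simp: C_def)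
      moreover have "(u' + a) mod g = (u + a) mod g"
        using that by (simp add: C_def)
      ultimately have "g dvd j' - j"
        by (metis add_diff_cancel_left' le_add1 mod_eq_dvd_iff_nat)
      then have "j' - j = 0"
        using that by (metis dvd_imp_le le_less_trans diff_le_self not_le neq0_conv)
      then show ?thesis
        using that by (auto simp: C_def)
    qed
    show "x = y"
      using eq[OF mem diff] eq[OF mem(2,1,4,3) diff[symmetric]] nat_le_linear[of i i'] unfolding xy by blast
  qed
  have "real g * sum \<alpha> C = (\<Sum>k\<in>C. \<Sum>i<g. \<alpha> k)"
    by (simp add: sum_distrib_left)
  also have "\<dots> \<le> (\<Sum>k\<in>C. \<Sum>i<g. 2 * \<alpha> (k - i))"
  proof (intro sum_mono)
    fix k i assume "k \<in> C" "i \<in> {..<g}"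
    then show "\<alpha> k \<le> 2 * \<alpha> (k - i)"
      using window[of "k - i" i] unfolding C_def by auto
  qed
  also have "\<dots> = 2 * sum \<alpha> ((\<lambda>(k, i). k - i) ` (C \<times> {..<g}))"
    using inj by (simp add: sum.reindex sum.cartesian_product split_def o_def sum_distrib_left)
  also have "\<dots> \<le> 2 * (\<Sum>k=1..n. \<alpha> k)"
  proof -
    have "(\<lambda>(k, i). k - i) ` (C \<times> {..<g}) \<subseteq> {1..n}"
      using \<open>1 \<le> K\<close> by (auto simp: C_def)
    then show ?thesis
      using pos by (intro mult_left_mono sum_mono2) auto
  qed
  finally show ?thesis
    by (simp add: C_def)
qed

text \<open>
  Dually, every index beyond \<open>K + g\<close> lies in one of the blocks \<open>k, k + 1, \<dots>, k + (g - 1)\<close> that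
  start at a multiple \<open>k \<ge> K\<close> of \<open>g\<close>, and each block weighs at most \<open>2 g \<alpha>\<^sub>k\<close>.
\<close>

lemma multiples_weight_ge:
  fixes \<alpha> :: "nat \<Rightarrow> real"
  assumes pos: "\<And>k. 1 \<le> k \<Longrightarrow> 0 \<le> \<alpha> k" and "1 \<le> K" and "0 < g"
    and window: "\<And>k i. K \<le> k \<Longrightarrow> i \<le> g \<Longrightarrow> \<alpha> (k + i) \<le> 2 * \<alpha> k"
  shows "(\<Sum>k=1..n. \<alpha> k) - (\<Sum>k=1..K + g. \<alpha> k) \<le> 2 * real g * sum \<alpha> {k \<in> {K..n}. g dvd k}"
proof -
  define C where "C = {k \<in> {K..n}. g dvd k}"
  have fin: "finite C"
    by (simp add: C_def)
  have cover: "{1..n} \<subseteq> {1..K + g} \<union> (\<lambda>(k, i). k + i) ` (C \<times> {..<g})"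
  proof
    fix l assume l: "l \<in> {1..n}"
    show "l \<in> {1..K + g} \<union> (\<lambda>(k, i). k + i) ` (C \<times> {..<g})"
    proof (cases "l \<le> K + g")
      case False
      define k where "k = l div g * g"
      have lk: "l = k + l mod g" "l mod g < g" "g dvd k"
        using \<open>0 < g\<close> by (simp_all add: k_def)
      then have "k \<in> C"
        using False l unfolding C_def by (intro CollectI conjI; simp; linarith)
      with lk show ?thesis
        by force
    qed (use l in auto)
  qed
  have ge1: "1 \<le> k" if "k \<in> C" for k
    using that \<open>1 \<le> K\<close> by (simp add: C_def)
  have "(\<Sum>k=1..n. \<alpha> k) \<le> sum \<alpha> ({1..K + g} \<union> (\<lambda>(k, i). k + i) ` (C \<times> {..<g}))"
    using cover fin pos ge1 by (intro sum_mono2) (auto intro!: pos dest: ge1)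
  also have "\<dots> \<le> (\<Sum>k=1..K + g. \<alpha> k) + sum \<alpha> ((\<lambda>(k, i). k + i) ` (C \<times> {..<g}))"
    using fin ge1 by (subst sum_Un) (auto intro!: sum_nonneg pos)
  also have "sum \<alpha> ((\<lambda>(k, i). k + i) ` (C \<times> {..<g})) \<le> sum (\<alpha> \<circ> (\<lambda>(k, i). k + i)) (C \<times> {..<g})"
    using fin ge1 by (intro sum_image_le) (auto intro!: pos simp: add_increasing2)
  also have "\<dots> = (\<Sum>k\<in>C. \<Sum>i<g. \<alpha> (k + i))"
    by (simp add: sum.cartesian_product split_def o_def)
  also have "\<dots> \<le> (\<Sum>k\<in>C. \<Sum>i<g. 2 * \<alpha> k)"
    by (intro sum_mono) (auto simp: C_def intro: window)
  also have "\<dots> = 2 * real g * sum \<alpha> C"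
    by (simp add: sum_distrib_left mult.assoc mult.left_commute)
  finally show ?thesis
    by (simp add: C_def)
qed

text \<open>
  An index closer than \<open>N\<close> to a multiple of \<open>g\<close> lies in one of at most \<open>2 N\<close> residue classes modulo \<open>g\<close>.
\<close>

lemma near_multiples_weight_le:
  fixes \<alpha> :: "nat \<Rightarrow> real"
  assumes pos: "\<And>k. 1 \<le> k \<Longrightarrow> 0 \<le> \<alpha> k" and "1 \<le> K"
    and window: "\<And>k i. K \<le> k \<Longrightarrow> i \<le> g \<Longrightarrow> \<alpha> (k + i) \<le> 2 * \<alpha> k"
    and L: "K + g + N \<le> L"
  shows "real g * sum \<alpha> {k \<in> {1..n}. \<exists>m\<ge>L. g dvd m \<and> k < m + N \<and> m < k + N}
           \<le> 4 * real N * (\<Sum>k=1..n. \<alpha> k)"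
proof -
  define B where "B = {k \<in> {1..n}. \<exists>m\<ge>L. g dvd m \<and> k < m + N \<and> m < k + N}"
  define D where "D = (\<lambda>e. e mod g) ` {..<2 * N}"
  have D: "(k + N) mod g \<in> D" and K: "K + g \<le> k" if "k \<in> B" for k
  proof -
    from that obtain m where m: "L \<le> m" "g dvd m" "k < m + N" "m < k + N"
      by (auto simp: B_def)
    have "(k + N) mod g = ((k + N - m) + m) mod g"
      using m by simp
    also have "\<dots> = (k + N - m) mod g"
      using m(2) by (metis dvd_eq_mod_eq_0 mod_add_right_eq add_0_right)
    finally show "(k + N) mod g \<in> D"
      using m by (auto simp: D_def)
    show "K + g \<le> k"
      using m L by simp
  qed
  have "card D \<le> card {..<2 * N}"
    unfolding D_def by (rule card_image_le) simp
  then have card: "real (card D) \<le> 2 * real N"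
    by simp
  have "real g * sum \<alpha> B = (\<Sum>d\<in>D. real g * sum \<alpha> {k \<in> B. (k + N) mod g = d})"
    using D by (subst sum.group[symmetric, of B D "\<lambda>k. (k + N) mod g"])
      (auto simp: B_def D_def sum_distrib_left)
  also have "\<dots> \<le> (\<Sum>d\<in>D. 2 * (\<Sum>k=1..n. \<alpha> k))"
  proof (rule sum_mono)
    fix d
    have "sum \<alpha> {k \<in> B. (k + N) mod g = d} \<le> sum \<alpha> {k \<in> {K + g..n}. (k + N) mod g = d}"
      using K \<open>1 \<le> K\<close> by (intro sum_mono2) (auto simp: B_def intro!: pos)
    then have "real g * sum \<alpha> {k \<in> B. (k + N) mod g = d}
        \<le> real g * sum \<alpha> {k \<in> {K + g..n}. (k + N) mod g = d}"
      by (intro mult_left_mono) auto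
    also have "\<dots> \<le> 2 * (\<Sum>k=1..n. \<alpha> k)"
      by (rule residue_class_weight_le[OF pos \<open>1 \<le> K\<close> window])
    finally show "real g * sum \<alpha> {k \<in> B. (k + N) mod g = d} \<le> 2 * (\<Sum>k=1..n. \<alpha> k)" .
  qed
  also have "\<dots> = 2 * real (card D) * (\<Sum>k=1..n. \<alpha> k)"
    by simp
  also have "\<dots> \<le> 4 * real N * (\<Sum>k=1..n. \<alpha> k)"
    using card by (intro mult_right_mono) (auto intro!: sum_nonneg pos)
  finally show ?thesis
    by (simp add: B_def)
qed

section \<open>Separated sets of positive lower density\<close>

text \<open>
  An additive error \<open>C\<close> is harmless since the total weight is unbounded. The passage to a superset
  \<open>E'\<close> is included because return sets are only known to contain a set of positive density.
\<close>

lemma lower_density_pos: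
  assumes pos: "\<And>k. 1 \<le> k \<Longrightarrow> 0 \<le> \<alpha> k"
    and unbounded: "filterlim (\<lambda>n. \<Sum>k=1..n. \<alpha> k) at_top sequentially"
    and "0 < c" and ge: "\<And>n. c * (\<Sum>k=1..n. \<alpha> k) - C \<le> sum \<alpha> ({1..n} \<inter> E)"
    and "E \<subseteq> E'"
  shows "0 < lower_density (weight_matrix \<alpha>) E'"
proof -
  have eq: "(\<Sum>\<^sub>\<infinity>k\<in>{1..}. weight_matrix \<alpha> n k * indicator E' k)
      = sum \<alpha> ({1..n} \<inter> E') / (\<Sum>k=1..n. \<alpha> k)" for n
  proof -
    have "(\<Sum>\<^sub>\<infinity>k\<in>{1..}. weight_matrix \<alpha> n k * indicator E' k)
        = (\<Sum>\<^sub>\<infinity>k\<in>{1..n} \<inter> E'. \<alpha> k / (\<Sum>k=1..n. \<alpha> k))"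
      by (rule infsum_cong_neutral) (auto simp: weight_matrix_def indicator_def)
    then show ?thesis
      by (simp add: sum_divide_distrib)
  qed
  have "\<forall>\<^sub>F n in sequentially. max 1 (2 * C / c) \<le> (\<Sum>k=1..n. \<alpha> k)"
    using unbounded unfolding filterlim_at_top by blast
  then have "\<forall>\<^sub>F n in sequentially.
      ereal (c / 2) \<le> ereal (\<Sum>\<^sub>\<infinity>k\<in>{1..}. weight_matrix \<alpha> n k * indicator E' k)"
  proof eventually_elim
    case (elim n)
    have "c / 2 * (\<Sum>k=1..n. \<alpha> k) \<le> c * (\<Sum>k=1..n. \<alpha> k) - C"
      using elim \<open>0 < c\<close> by (simp add: field_simps)
    also have "\<dots> \<le> sum \<alpha> ({1..n} \<inter> E)"
      by (rule ge)
    also have "\<dots> \<le> sum \<alpha> ({1..n} \<inter> E')"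
      using \<open>E \<subseteq> E'\<close> by (intro sum_mono2) (auto intro!: pos)
    finally show ?case
      unfolding eq using elim by (simp add: pos_le_divide_eq)
  qed
  then have "ereal (c / 2) \<le> lower_density (weight_matrix \<alpha>) E'"
    unfolding lower_density_def by (rule Liminf_bounded)
  moreover have "0 < ereal (c / 2)"
    using \<open>0 < c\<close> by simp
  ultimately show ?thesis
    by (rule less_le_trans[rotated])
qed

lemma sum_half_powers_le: "(\<Sum>q\<in>I. (1/2::real) ^ q) \<le> 2" if "finite I"
proof -
  have "(\<Sum>q\<in>I. (1/2::real) ^ q) \<le> (\<Sum>q. (1/2) ^ q)"
    using that by (intro sum_le_suminf summable_geometric) auto
  then show ?thesis
    by (simp add: suminf_geometric)
qed

text \<open>
  Here \<open>E p\<close> consists of the multiples of \<open>g p\<close> from \<open>L p\<close> on, without those closer than \<open>N q\<close> to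
  a multiple of \<open>g q\<close> from \<open>L q\<close> on, for some \<open>q > p\<close>. Separation is built in. For the density, the
  progression of \<open>g p\<close> has weight at least \<open>1 / (2 g p)\<close> of the total up to a constant, while
  the deleted sets have weight at most \<open>\<Sum>\<^sub>q\<^sub>>\<^sub>p 4 N q / g q \<le> 1 / (4 g p)\<close> of the total. The starting
  index \<open>L q\<close> is chosen where the weights at most double over windows of length \<open>g q\<close>.
\<close>

lemma separated_sets_of_positive_lower_density:
  fixes \<alpha> :: "nat \<Rightarrow> real" and N :: "nat \<Rightarrow> nat"
  assumes pos: "\<And>k. 1 \<le> k \<Longrightarrow> 0 < \<alpha> k"
    and ratio: "(\<lambda>k. \<alpha> (Suc k) / \<alpha> k) \<longlonglongrightarrow> 1"
    and unbounded: "filterlim (\<lambda>n. \<Sum>k=1..n. \<alpha> k) at_top sequentially"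
    and N: "mono N" "\<And>p. 1 \<le> N p"
  obtains E :: "nat \<Rightarrow> nat set"
  where "\<And>p n. n \<in> E p \<Longrightarrow> N p \<le> n"
    and "\<And>p q n m. n \<in> E p \<Longrightarrow> m \<in> E q \<Longrightarrow> p \<noteq> q \<or> n \<noteq> m \<Longrightarrow>
           n + N (max p q) \<le> m \<or> m + N (max p q) \<le> n"
    and "\<And>p E'. E p \<subseteq> E' \<Longrightarrow> 0 < lower_density (weight_matrix \<alpha>) E'"
proof -
  (* The factor N (Suc q) cancels the number of residue classes deleted at stage Suc q, the factor g q
     makes the deletion small relative to the density of the progressions of earlier stages, and
     the power of 2 makes the deletions summable over q. *)
  define g where "g = rec_nat (N 0) (\<lambda>q h. 2 ^ (q + 5) * N (Suc q) * h)"
  have g_0: "g 0 = N 0" and g_Suc: "g (Suc q) = 2 ^ (q + 5) * N (Suc q) * g q" for q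
    by (simp_all add: g_def)
  have g_pos: "0 < g q" for q
    using N(2) by (induction q) (auto simp: g_0 g_Suc Suc_le_eq)
  have N_le_g: "N q \<le> g q" for q
    using g_pos by (cases q) (auto simp: g_0 g_Suc Suc_le_eq)
  have "mono g"
    unfolding mono_iff_le_Suc using N(2) by (auto simp: g_Suc Suc_le_eq)
  have nonneg: "0 \<le> \<alpha> k" if "1 \<le> k" for k
    using pos[OF that] by simp

  have "\<exists>K\<ge>1. \<forall>k\<ge>K. \<forall>i\<le>g q. \<alpha> (k + i) \<le> 2 * \<alpha> k" for q
  proof -
    obtain K where "\<forall>k\<ge>K. \<forall>i\<in>{..g q}. \<alpha> (k + i) \<le> 2 * \<alpha> k"
      using eventually_at_most_doubles_on_windows[OF pos ratio]
      unfolding eventually_sequentially by blast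
    then show ?thesis
      by (intro exI[of _ "max K 1"]) auto
  qed
  then obtain K where K1: "\<And>q. 1 \<le> K q"
    and window: "\<And>q k i. K q \<le> k \<Longrightarrow> i \<le> g q \<Longrightarrow> \<alpha> (k + i) \<le> 2 * \<alpha> k"
    by metis
  (* The summand q ensures that B q contains no index up to n once q exceeds n, so that only
     finitely many deletions concern {1..n}. *)
  define L where "L q = K q + g q + N q + q" for q
  define B where "B q = {k. \<exists>m\<ge>L q. g q dvd m \<and> k < m + N q \<and> m < k + N q}" for q
  define E where "E p = {n. g p dvd n \<and> L p \<le> n} - (\<Union>q\<in>{p<..}. B q)" for p

  show thesis
  proof
    show "N p \<le> n" if "n \<in> E p" for n p
      using that by (simp add: E_def L_def)
  next
    fix p q n m assume *: "n \<in> E p" "m \<in> E q" "p \<noteq> q \<or> n \<noteq> m"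
    have far: "u + N b \<le> v \<or> v + N b \<le> u" if "a < b" "u \<in> E a" "v \<in> E b" for a b u v
    proof -
      have "u \<notin> B b" "g b dvd v" "L b \<le> v"
        using that by (auto simp: E_def)
      then show ?thesis
        by (auto simp: B_def not_less)
    qed
    show "n + N (max p q) \<le> m \<or> m + N (max p q) \<le> n"
    proof (cases p q rule: linorder_cases)
      case less
      then show ?thesis using far[of p q n m] * by (simp add: max_def)
    next
      case greater
      then show ?thesis using far[of q p m n] * by (auto simp: max_def)
    next
      case equal
      then have "g p dvd n" "g p dvd m" "n \<noteq> m"
        using * by (auto simp: E_def)
      then have "n + g p \<le> m \<or> m + g p \<le> n"
        by (smt (verit, ccfv_threshold) diff_is_0_eq dvd_diff_nat dvd_imp_le le_diff_conv2
            nat_le_linear not_gr_zero add.commute le_antisym)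
      then show ?thesis
        using equal N_le_g[of p] by auto
    qed
  next
    fix p E' assume "E p \<subseteq> E'"
    define C where "C = (\<Sum>k=1..L p + g p. \<alpha> k)"
    have B_le: "sum \<alpha> ({1..n} \<inter> B (Suc q)) \<le> (1/2) ^ q / (8 * real (g p)) * (\<Sum>k=1..n. \<alpha> k)"
      if "p \<le> q" for q n
    proof -
      let ?W = "\<Sum>k=1..n. \<alpha> k" and ?q = "Suc q"
      have W0: "0 \<le> ?W"
        by (intro sum_nonneg nonneg) auto
      have "real (g ?q) * sum \<alpha> ({1..n} \<inter> B ?q) \<le> 4 * real (N ?q) * ?W"
        using near_multiples_weight_le[OF nonneg K1 window , where N = "N ?q" and g = "g ?q"]
        by (simp add: B_def L_def Int_def)
      then have "sum \<alpha> ({1..n} \<inter> B ?q) \<le> 4 * real (N ?q) * ?W / real (g ?q)"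
        using g_pos[of ?q] by (simp add: field_simps)
      also have "\<dots> = (1/2) ^ q / (8 * real (g q)) * ?W"
        using N(2)[of ?q] g_pos[of q] by (simp add: g_Suc field_simps power_add)
      also have "\<dots> \<le> (1/2) ^ q / (8 * real (g p)) * ?W"
        using W0 \<open>mono g\<close> that g_pos
        by (intro mult_right_mono divide_left_mono) (auto simp: monoD)
      finally show ?thesis .
    qed
    show "0 < lower_density (weight_matrix \<alpha>) E'"
    proof (rule lower_density_pos[OF nonneg unbounded _ _ \<open>E p \<subseteq> E'\<close>])
      show "0 < 1 / (4 * real (g p))"
        using g_pos by simp
    next
      fix n
      let ?W = "\<Sum>k=1..n. \<alpha> k"
      have W0: "0 \<le> ?W"
        by (intro sum_nonneg nonneg) auto
      have "?W - C \<le> 2 * real (g p) * sum \<alpha> {k \<in> {L p..n}. g p dvd k}"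
        unfolding C_def using K1[of p] g_pos[of p]
        by (intro multiples_weight_ge nonneg window) (auto simp: L_def)
      then have "?W / (2 * real (g p)) - C / (2 * real (g p)) \<le> sum \<alpha> {k \<in> {L p..n}. g p dvd k}"
        using g_pos[of p] by (simp add: field_simps)
      also have "\<dots> \<le> sum \<alpha> (({1..n} \<inter> E p) \<union> (\<Union>q\<in>{p..<n}. {1..n} \<inter> B (Suc q)))"
      proof (intro sum_mono2 subsetI)
        fix k assume k: "k \<in> {k \<in> {L p..n}. g p dvd k}"
        have "k \<in> E p \<or> (\<exists>q\<in>{p<..}. k \<in> B q)"
          using k by (auto simp: E_def)
        moreover have "\<exists>q'\<in>{p..<n}. q = Suc q'" if "k \<in> B q" "p < q" for q
          using that k by (intro bexI[of _ "q - 1"]) (auto simp: B_def L_def)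
        moreover have "k \<in> {1..n}"
          using k K1[of p] by (auto simp: L_def)
        ultimately show "k \<in> ({1..n} \<inter> E p) \<union> (\<Union>q\<in>{p..<n}. {1..n} \<inter> B (Suc q))"
          by blast
      qed (auto intro!: nonneg)
      also have "\<dots> \<le> sum \<alpha> ({1..n} \<inter> E p) + sum \<alpha> (\<Union>q\<in>{p..<n}. {1..n} \<inter> B (Suc q))"
        by (subst sum_Un) (auto intro!: sum_nonneg nonneg)
      also have "sum \<alpha> (\<Union>q\<in>{p..<n}. {1..n} \<inter> B (Suc q))
          \<le> (\<Sum>q\<in>{p..<n}. sum \<alpha> ({1..n} \<inter> B (Suc q)))"
        by (rule sum_Union_le) (auto intro!: nonneg)
      also have "\<dots> \<le> (\<Sum>q\<in>{p..<n}. (1/2) ^ q / (8 * real (g p)) * ?W)"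
        by (intro sum_mono B_le) auto
      also have "\<dots> = (\<Sum>q\<in>{p..<n}. (1/2) ^ q) * (?W / (8 * real (g p)))"
        unfolding sum_distrib_right by (rule sum.cong) simp_all
      also have "\<dots> \<le> 2 * (?W / (8 * real (g p)))"
        using W0 by (intro mult_right_mono sum_half_powers_le) auto
      finally show "1 / (4 * real (g p)) * ?W - C / (2 * real (g p)) \<le> sum \<alpha> ({1..n} \<inter> E p)"
        by simp
    qed
  qed
qed

section \<open>The ratio of consecutive weights\<close>

text \<open>
  The bound passes from \<open>l = log\<^sup>(\<^sup>s\<^sup>) x\<close> to \<open>ln l\<close> because \<open>ln (l + d) - ln l \<le> d / l \<le> d\<close> as soon as
  \<open>l \<ge> 1\<close>.
\<close>

lemma iterated_ln_increment:
  assumes "1 \<le> s"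
  shows "\<forall>\<^sub>F x in at_top.
    0 \<le> (ln ^^ s) (x + 1) - (ln ^^ s) x \<and> (ln ^^ s) (x + 1) - (ln ^^ s) x \<le> 1 / (x :: real)"
  using assms
proof (induction s rule: nat_induct_at_least)
  case base
  show ?case
    using eventually_gt_at_top[of 0]
  proof eventually_elim
    case (elim x)
    have "ln (x + 1) = ln (x * (1 + 1 / x))"
      using elim by (simp add: distrib_left)
    also have "\<dots> = ln x + ln (1 + 1 / x)"
      using elim by (intro ln_mult_pos) (auto simp: add_pos_pos)
    finally have "ln (x + 1) - ln x = ln (1 + 1 / x)"
      by simp
    also have "\<dots> \<le> 1 / x"
      using elim by (intro ln_add_one_self_le_self) simp
    finally show ?case
      using elim by simp
  qed
next
  case (Suc s)
  have "\<forall>\<^sub>F x in at_top. 1 \<le> (ln ^^ s) (x :: real)"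
    using filterlim_iterated_ln[of s] by (simp add: filterlim_at_top)
  with Suc.IH show ?case
  proof eventually_elim
    case (elim x)
    define l where "l = (ln ^^ s) x"
    define d where "d = (ln ^^ s) (x + 1) - l"
    have d: "0 \<le> d" "d \<le> 1 / x" "1 \<le> l"
      using elim by (auto simp: l_def d_def)
    have eq: "(ln ^^ s) (x + 1) = l + d"
      by (simp add: d_def)
    have "ln (l + d) = ln (l * (1 + d / l))"
      using d by (simp add: distrib_left)
    also have "\<dots> = ln l + ln (1 + d / l)"
      using d by (intro ln_mult_pos) (auto simp: add_pos_nonneg)
    finally have "ln (l + d) - ln l = ln (1 + d / l)"
      by simp
    also have "\<dots> \<le> d / l"
      using d by (intro ln_add_one_self_le_self) simp
    also have "\<dots> \<le> d"
      using d mult_left_mono[of 1 l d] by (simp add: divide_le_eq)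
    finally have "ln (l + d) - ln l \<le> 1 / x"
      using d by simp
    then show ?case
      using d by (simp add: eq l_def[symmetric])
  qed
qed

text \<open>
  With \<open>L\<^sub>k = log\<^sup>(\<^sup>s\<^sup>) k\<close> and \<open>d = L\<^sub>k\<^sub>+\<^sub>1 - L\<^sub>k\<close>, the exponents differ by \<open>(1 - k d / L\<^sub>k) / L\<^sub>k\<^sub>+\<^sub>1\<close>,
  which tends to 0 because \<open>0 \<le> k d \<le> 1\<close>.
\<close>

lemma D_tilde_weights_ratio:
  assumes "1 \<le> s" and "D_tilde_weights s \<alpha>"
  shows "(\<lambda>k. \<alpha> (Suc k) / \<alpha> k) \<longlonglongrightarrow> 1"
proof -
  define L where "L k = (ln ^^ s) (real k)" for k :: nat
  have L_top: "filterlim L at_top sequentially"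
    unfolding L_def by (rule filterlim_compose[OF filterlim_iterated_ln filterlim_real_sequentially])
  have L1: "\<forall>\<^sub>F k in sequentially. 1 \<le> L k"
    using L_top by (simp add: filterlim_at_top)
  have inc: "\<forall>\<^sub>F k in sequentially. 0 \<le> L (Suc k) - L k \<and> L (Suc k) - L k \<le> 1 / real k"
    using eventually_compose_filterlim[OF iterated_ln_increment[OF \<open>1 \<le> s\<close>] filterlim_real_sequentially]
    by (simp add: L_def add.commute)
  have "(\<lambda>k. real (Suc k) / L (Suc k) - real k / L k) \<longlonglongrightarrow> 0"
  proof (rule Lim_null_comparison)
    show "\<forall>\<^sub>F k in sequentially. norm (real (Suc k) / L (Suc k) - real k / L k) \<le> 2 / L k"
      using L1 inc eventually_gt_at_top[of 0]
    proof eventually_elim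
      case (elim k)
      define d where "d = L (Suc k) - L k"
      have d: "0 \<le> d" "real k * d \<le> 1" and eq: "L (Suc k) = L k + d"
        using elim by (auto simp: d_def field_simps)
      have "real (Suc k) / L (Suc k) - real k / L k = (1 - real k * d / L k) / (L k + d)"
        using elim d by (simp add: eq field_simps)
      also have "\<bar>\<dots>\<bar> \<le> 2 / (L k + d)"
      proof -
        have "0 \<le> real k * d / L k" "real k * d / L k \<le> 1"
          using elim d by (auto simp: divide_le_eq)
        then have "\<bar>1 - real k * d / L k\<bar> \<le> 2"
          by linarith
        then show ?thesis
          using elim d by (simp add: abs_divide divide_right_mono)
      qed
      also have "\<dots> \<le> 2 / L k"
        using elim d by (intro divide_left_mono) auto
      finally show ?case
        by simp
    qed
    show "(\<lambda>k. 2 / L k) \<longlonglongrightarrow> 0"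
      by (rule tendsto_divide_0[OF tendsto_const filterlim_at_top_imp_at_infinity[OF L_top]])
  qed
  from tendsto_exp[OF this]
  have "(\<lambda>k. exp (real (Suc k) / L (Suc k) - real k / L k)) \<longlonglongrightarrow> 1"
    by simp
  moreover have "\<forall>\<^sub>F k in sequentially.
      exp (real (Suc k) / L (Suc k) - real k / L k) = \<alpha> (Suc k) / \<alpha> k"
  proof -
    have ev: "\<forall>\<^sub>F k in sequentially. \<alpha> k = exp (real k / L k)"
      using assms(2) by (simp add: D_tilde_weights_def L_def)
    then have "\<forall>\<^sub>F k in sequentially. \<alpha> (Suc k) = exp (real (Suc k) / L (Suc k))"
      by (subst eventually_sequentially_Suc)
    with ev show ?thesis
      by eventually_elim (simp add: exp_diff)
  qed
  ultimately show ?thesis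
    by (rule Lim_transform_eventually)
qed


section \<open>Frechet spaces with an increasing sequence of seminorms\<close>

text \<open>
  For an increasing sequence the balls of the single seminorms form a base of neighbourhoods, so
  that each estimate involves one seminorm only.
\<close>

definition graded_seminorms ::
    "(nat \<Rightarrow> 'a::{real_vector, topological_space} \<Rightarrow> real) \<Rightarrow> bool" where
  "graded_seminorms p \<longleftrightarrow>
     (\<forall>n. seminorm (p n)) \<and> (\<forall>x. mono (\<lambda>n. p n x)) \<and>
     (\<forall>U. open U \<longleftrightarrow> (\<forall>x\<in>U. \<exists>n. \<exists>\<epsilon>>0. \<forall>y. p n (y - x) < \<epsilon> \<longrightarrow> y \<in> U))"

lemma seminorm_zero: "seminorm p \<Longrightarrow> p 0 = 0"
  unfolding seminorm_def by (metis abs_zero mult_zero_left scale_zero_left)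

lemma seminorm_minus_commute: "seminorm p \<Longrightarrow> p (x - y) = p (y - x)"
  unfolding seminorm_def
  by (metis abs_minus_cancel abs_one minus_diff_eq mult_1 scaleR_minus1_left)

lemma seminorm_triangle: "seminorm p \<Longrightarrow> p (x + y) \<le> p x + p y"
  by (simp add: seminorm_def)

lemma seminorm_nonneg: "0 \<le> p x" if "seminorm p"
  using seminorm_triangle[OF that, of x "- x"] seminorm_minus_commute[OF that, of 0 x]
    seminorm_zero[OF that] by simp

lemma seminorm_triangle_diff: "seminorm p \<Longrightarrow> p (x - z) \<le> p (x - y) + p (y - z)"
  using seminorm_triangle[of p "x - y" "y - z"] by simp

lemma seminorm_sum_le: "seminorm p \<Longrightarrow> p (sum f A) \<le> (\<Sum>i\<in>A. p (f i))"
proof (induction A rule: infinite_finite_induct)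
  case (insert i A)
  then show ?case
    using seminorm_triangle[of p "f i" "sum f A"] by simp
qed (simp_all add: seminorm_zero)

lemma graded_seminormsD:
  assumes "graded_seminorms p"
  shows "seminorm (p n)" and "m \<le> n \<Longrightarrow> p m x \<le> p n x"
    and "open U \<Longrightarrow> x \<in> U \<Longrightarrow> \<exists>n. \<exists>\<epsilon>>0. \<forall>y. p n (y - x) < \<epsilon> \<longrightarrow> y \<in> U"
  using assms by (auto simp: graded_seminorms_def mono_def)

lemma graded_seminorms_open_ball:
  assumes "graded_seminorms p"
  shows "open {y. p n (y - x) < e}"
proof -
  have "\<exists>m. \<exists>\<epsilon>>0. \<forall>z. p m (z - y) < \<epsilon> \<longrightarrow> z \<in> {y. p n (y - x) < e}"
    if "p n (y - x) < e" for y
  proof (intro exI[of _ n] exI[of _ "e - p n (y - x)"] conjI allI impI CollectI)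
    fix z assume "p n (z - y) < e - p n (y - x)"
    then show "p n (z - x) < e"
      using seminorm_triangle_diff[OF graded_seminormsD(1)[OF assms], of n z x y] by linarith
  qed (use that in simp)
  then show ?thesis
    using assms unfolding graded_seminorms_def by simp
qed

text \<open>
  Partial sums of a defining sequence of seminorms are increasing and define the same topology and the
  same Cauchy sequences.
\<close>

lemma frechet_graded_seminorms:
  obtains p :: "nat \<Rightarrow> 'a::frechet_space \<Rightarrow> real"
  where "graded_seminorms p"
    and "\<forall>u. (\<forall>n. \<forall>\<epsilon>>0. \<exists>M. \<forall>i\<ge>M. \<forall>j\<ge>M. p n (u i - u j) < \<epsilon>) \<longrightarrow>
           (\<exists>l. \<forall>n. (\<lambda>i. p n (u i - l)) \<longlonglongrightarrow> 0)"
proof -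
  obtain p0 :: "nat \<Rightarrow> 'a \<Rightarrow> real" where
    semi': "\<forall>n. seminorm (p0 n)" and
    top: "\<forall>U. open U \<longleftrightarrow>
          (\<forall>x\<in>U. \<exists>N. \<exists>\<epsilon>>0. \<forall>y. (\<forall>n\<le>N. p0 n (y - x) < \<epsilon>) \<longrightarrow> y \<in> U)" and
    complete: "\<forall>u :: nat \<Rightarrow> 'a.
          (\<forall>n. \<forall>\<epsilon>>0. \<exists>M. \<forall>i\<ge>M. \<forall>j\<ge>M. p0 n (u i - u j) < \<epsilon>) \<longrightarrow>
          (\<exists>l. \<forall>n. (\<lambda>i. p0 n (u i - l)) \<longlonglongrightarrow> 0)"
    using frechet_seminorms[where 'a = 'a] by (elim exE conjE) (rule that)
  note semi = semi'[rule_format]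
  define p where "p n x = (\<Sum>i\<le>n. p0 i x)" for n x
  have nonneg: "0 \<le> p0 n x" for n x
    by (rule seminorm_nonneg[OF semi])
  have p0_le: "p0 i x \<le> p n x" if "i \<le> n" for i n x
    unfolding p_def using that nonneg by (intro member_le_sum) auto
  have "seminorm (p n)" for n
    unfolding seminorm_def
  proof (intro conjI allI)
    show "p n (x + y) \<le> p n x + p n y" for x y
      unfolding p_def sum.distrib[symmetric] by (intro sum_mono seminorm_triangle semi)
    show "p n (c *\<^sub>R x) = \<bar>c\<bar> * p n x" for c x
      using semi unfolding p_def seminorm_def by (simp add: sum_distrib_left)
  qed
  moreover have "mono (\<lambda>n. p n x)" for x
    unfolding mono_iff_le_Suc by (simp add: p_def nonneg)
  moreover have "(\<exists>N. \<exists>\<epsilon>>0. \<forall>y. (\<forall>n\<le>N. p0 n (y - x) < \<epsilon>) \<longrightarrow> y \<in> U) \<longleftrightarrow>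
      (\<exists>n. \<exists>\<epsilon>>0. \<forall>y. p n (y - x) < \<epsilon> \<longrightarrow> y \<in> U)" for U x
  proof
    assume "\<exists>N. \<exists>\<epsilon>>0. \<forall>y. (\<forall>n\<le>N. p0 n (y - x) < \<epsilon>) \<longrightarrow> y \<in> U"
    then show "\<exists>n. \<exists>\<epsilon>>0. \<forall>y. p n (y - x) < \<epsilon> \<longrightarrow> y \<in> U"
      using p0_le by (meson le_less_trans)
  next
    assume "\<exists>n. \<exists>\<epsilon>>0. \<forall>y. p n (y - x) < \<epsilon> \<longrightarrow> y \<in> U"
    then obtain n \<epsilon> where *: "0 < \<epsilon>" "\<And>y. p n (y - x) < \<epsilon> \<Longrightarrow> y \<in> U"
      by blast
    have "p n z < \<epsilon>" if "\<forall>i\<le>n. p0 i z < \<epsilon> / real (Suc n)" for z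
    proof -
      have "p n z < real (card {..n}) * (\<epsilon> / real (Suc n))"
        unfolding p_def using that by (intro sum_bounded_above_strict) auto
      then show ?thesis by simp
    qed
    with * show "\<exists>N. \<exists>\<epsilon>>0. \<forall>y. (\<forall>n\<le>N. p0 n (y - x) < \<epsilon>) \<longrightarrow> y \<in> U"
      by (intro exI[of _ n] exI[of _ "\<epsilon> / real (Suc n)"]) auto
  qed
  ultimately have "graded_seminorms p"
    unfolding graded_seminorms_def using top by simp
  moreover have "\<exists>l. \<forall>n. (\<lambda>i. p n (u i - l)) \<longlonglongrightarrow> 0"
    if u: "\<forall>n. \<forall>\<epsilon>>0. \<exists>M. \<forall>i\<ge>M. \<forall>j\<ge>M. p n (u i - u j) < \<epsilon>" for u
  proof -
    have "\<forall>n. \<forall>\<epsilon>>0. \<exists>M. \<forall>i\<ge>M. \<forall>j\<ge>M. p0 n (u i - u j) < \<epsilon>"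
      using u p0_le by (meson le_less_trans order_refl)
    then obtain l where "\<And>n. (\<lambda>i. p0 n (u i - l)) \<longlonglongrightarrow> 0"
      using complete by meson
    then have "(\<lambda>i. p n (u i - l)) \<longlonglongrightarrow> 0" for n
      unfolding p_def by (intro tendsto_null_sum)
    then show ?thesis by blast
  qed
  ultimately show thesis
    using that by blast
qed

text \<open>
  A finite set far out is disjoint from a finite set \<open>X\<close> whose sum is close to the limit; its sum is
  the difference of two sums over sets containing \<open>X\<close>.
\<close>

lemma summable_on_eventually_small:
  fixes f :: "nat \<Rightarrow> 'a::{real_vector, topological_space}"
  assumes G: "graded_seminorms p" and f: "f summable_on A" and "0 < e"
  shows "\<forall>\<^sub>F N in sequentially. \<forall>F. finite F \<and> F \<subseteq> A \<inter> {N..} \<longrightarrow> p n (sum f F) < e"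
proof -
  note semi = graded_seminormsD(1)[OF G]
  obtain l where "(sum f \<longlongrightarrow> l) (finite_subsets_at_top A)"
    using f by (auto simp: summable_on_def has_sum_def)
  then have "\<forall>\<^sub>F F in finite_subsets_at_top A. sum f F \<in> {y. p n (y - l) < e / 2}"
    by (rule topological_tendstoD[OF _ graded_seminorms_open_ball[OF G]])
      (use \<open>0 < e\<close> in \<open>simp add: seminorm_zero[OF semi]\<close>)
  then obtain X where X: "finite X" "X \<subseteq> A"
    and close: "\<And>Y. finite Y \<Longrightarrow> X \<subseteq> Y \<Longrightarrow> Y \<subseteq> A \<Longrightarrow> p n (sum f Y - l) < e / 2"
    unfolding eventually_finite_subsets_at_top by auto
  obtain M where M: "X \<subseteq> {..<M}"
    using X(1) finite_nat_iff_bounded by blast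
  have "p n (sum f F) < e" if "M \<le> N" "finite F" "F \<subseteq> A \<inter> {N..}" for N F
  proof -
    have "X \<inter> F = {}"
      using M that by force
    then have "sum f F = sum f (X \<union> F) - sum f X"
      using X that by (simp add: sum.union_disjoint)
    also have "p n \<dots> \<le> p n (sum f (X \<union> F) - l) + p n (l - sum f X)"
      by (rule seminorm_triangle_diff[OF semi])
    also have "\<dots> < e"
      using close[of X] close[of "X \<union> F"] X that
      by (auto simp: seminorm_minus_commute[OF semi, of _ l])
    finally show ?thesis .
  qed
  then show ?thesis
    unfolding eventually_sequentially by blast
qed

lemma uniformly_unconditionally_summable_eventually_small:
  assumes G: "graded_seminorms p" and f: "uniformly_unconditionally_summable f" and "0 < e"
  shows "\<forall>\<^sub>F N in sequentially. \<forall>k\<ge>1. \<forall>F. finite F \<and> F \<subseteq> {N..} \<longrightarrow> p n (sum (f k) F) < e"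
proof -
  let ?W = "{y. p n (y - 0) < e}"
  have "open ?W"
    by (rule graded_seminorms_open_ball[OF G])
  then have "0 \<in> interior ?W"
    using \<open>0 < e\<close> seminorm_zero[OF graded_seminormsD(1)[OF G]] by (simp add: interior_open)
  then obtain M where M: "\<And>k F. 1 \<le> k \<Longrightarrow> finite F \<Longrightarrow> F \<subseteq> {M..} \<Longrightarrow> sum (f k) F \<in> ?W"
    using f unfolding uniformly_unconditionally_summable_def by meson
  have "p n (sum (f k) F) < e" if "M \<le> N" "1 \<le> k" "finite F" "F \<subseteq> {N..}" for N k F
    using M[of k F] that by force
  then show ?thesis
    unfolding eventually_sequentially by blast
qed

text \<open>
  The dense set \<open>Y\<^sub>0\<close> may be uncountable: approximate each element of a countable dense set by elements
  of \<open>Y\<^sub>0\<close>, with precision \<open>1 / (m + 1)\<close> for every \<open>m\<close>. An open set contains the approximations of one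
  of these elements for all large \<open>m\<close>, hence terms of the enumeration with arbitrarily large index.
\<close>

lemma separable_dense_sequence:
  fixes q :: "nat \<Rightarrow> 'b::{real_vector, topological_space} \<Rightarrow> real" and Y\<^sub>0 :: "'b set"
  assumes G: "graded_seminorms q"
    and sep: "separable_space (euclidean :: 'b topology)" and dense: "closure Y\<^sub>0 = UNIV"
  obtains y :: "nat \<Rightarrow> 'b"
  where "\<And>r. y r \<in> Y\<^sub>0"
    and "\<And>U j. open U \<Longrightarrow> U \<noteq> {} \<Longrightarrow> \<exists>r\<ge>j. y r \<in> U"
proof -
  note semi = graded_seminormsD(1)[OF G]
  obtain C :: "'b set" where C: "countable C" "closure C = UNIV"
    using sep by (auto simp: separable_space_def)
  have meets: "\<exists>c\<in>D. q n (c - x) < e" if "closure D = UNIV" "0 < e" for D :: "'b set" and n x e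
  proof -
    have "x \<in> {z. q n (z - x) < e}"
      using that(2) by (simp add: seminorm_zero[OF semi])
    then show ?thesis
      using open_Int_closure_eq_empty[OF graded_seminorms_open_ball[OF G], of n x e D] that(1)
      by blast
  qed
  have "C \<noteq> {}"
    using C(2) by auto
  define z where
    "z i n = (SOME z. z \<in> Y\<^sub>0 \<and> q n (z - from_nat_into C i) < inverse (real (Suc n)))" for i n
  have z: "z i n \<in> Y\<^sub>0 \<and> q n (z i n - from_nat_into C i) < inverse (real (Suc n))" for i n
  proof -
    have "\<exists>z. z \<in> Y\<^sub>0 \<and> q n (z - from_nat_into C i) < inverse (real (Suc n))"
      using meets[OF dense, of "inverse (real (Suc n))" n "from_nat_into C i"] by auto
    then show ?thesis
      unfolding z_def by (rule someI_ex)
  qed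
  show thesis
  proof
    show "case_prod z (prod_decode r) \<in> Y\<^sub>0" for r
      by (simp add: split_def z)
  next
    fix U :: "'b set" and j assume U: "open U" "U \<noteq> {}"
    then obtain u where "u \<in> U" by blast
    then obtain n \<epsilon> where "0 < \<epsilon>" and ball: "\<And>v. q n (v - u) < \<epsilon> \<Longrightarrow> v \<in> U"
      using graded_seminormsD(3)[OF G U(1)] by blast
    obtain c where c: "c \<in> C" "q n (c - u) < \<epsilon> / 2"
      using meets[OF C(2), of "\<epsilon> / 2" n u] \<open>0 < \<epsilon>\<close> by auto
    obtain i where i: "c = from_nat_into C i"
      using from_nat_into_surj[OF C(1) c(1)] by metis
    obtain m0 where m0: "inverse (real (Suc m0)) < \<epsilon> / 2"
      using reals_Archimedean[of "\<epsilon> / 2"] \<open>0 < \<epsilon>\<close> by auto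
    define m where "m = max m0 (max n j)"
    have "q n (z i m - u) \<le> q n (z i m - c) + q n (c - u)"
      by (rule seminorm_triangle_diff[OF semi])
    also have "q n (z i m - c) \<le> q m (z i m - c)"
      by (rule graded_seminormsD(2)[OF G]) (simp add: m_def)
    also have "\<dots> < inverse (real (Suc m))"
      unfolding i using z by blast
    also have "\<dots> \<le> inverse (real (Suc m0))"
      by (simp add: m_def)
    finally have "z i m \<in> U"
      using m0 c by (intro ball) linarith
    moreover have "j \<le> prod_encode (i, m)"
      using le_prod_encode_2[of m i] by (simp add: m_def)
    ultimately show "\<exists>r\<ge>j. case_prod z (prod_decode r) \<in> U"
      by (intro exI[of _ "prod_encode (i, m)"]) simp
  qed
qed

section \<open>The criterion\<close>

text \<open>
  The distances \<open>N p\<close> are chosen such that for \<open>M = max p r\<close> the terms \<open>T\<^sub>k S\<^sub>m y\<^sub>r\<close> with \<open>m < k\<close>, and likewise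
  those with \<open>m > k\<close>, sum to less than \<open>4\<^sup>-\<^sup>M\<close> whenever all \<open>m\<close> are at distance at least \<open>N M\<close>
  from \<open>k\<close>. Since \<open>4\<^sup>-\<^sup>M \<le> 2\<^sup>-\<^sup>p 2\<^sup>-\<^sup>r\<close>, summing over \<open>r\<close> leaves an error of order \<open>2\<^sup>-\<^sup>p\<close>.
\<close>

theorem frequent_universality_criterion_slowly_varying_weights:
  fixes T :: "nat \<Rightarrow> 'a::frechet_space \<Rightarrow> 'b::frechet_space"
    and S :: "nat \<Rightarrow> 'b \<Rightarrow> 'a"
    and Y\<^sub>0 :: "'b set"
    and \<alpha> :: "nat \<Rightarrow> real"
  assumes sep: "separable_space (euclidean :: 'b topology)"
    and lin: "\<And>n. 1 \<le> n \<Longrightarrow> linear (T n)"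
    and cont: "\<And>n. 1 \<le> n \<Longrightarrow> continuous_on UNIV (T n)"
    and dense: "closure Y\<^sub>0 = UNIV"
    and below: "\<And>y. y \<in> Y\<^sub>0 \<Longrightarrow>
           uniformly_unconditionally_summable (\<lambda>k n. if n < k then T k (S (k - n) y) else 0)"
    and above: "\<And>y. y \<in> Y\<^sub>0 \<Longrightarrow>
           uniformly_unconditionally_summable (\<lambda>k n. T k (S (k + n) y))"
    and summable: "\<And>y. y \<in> Y\<^sub>0 \<Longrightarrow> (\<lambda>n. S n y) summable_on {1..}"
    and right_inverse: "\<And>y. y \<in> Y\<^sub>0 \<Longrightarrow> (\<lambda>n. T n (S n y)) \<longlonglongrightarrow> y"
    and pos: "\<And>k. 1 \<le> k \<Longrightarrow> 0 < \<alpha> k"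
    and ratio: "(\<lambda>k. \<alpha> (Suc k) / \<alpha> k) \<longlonglongrightarrow> 1"
    and unbounded: "filterlim (\<lambda>n. \<Sum>k=1..n. \<alpha> k) at_top sequentially"
  shows "frequently_universal (weight_matrix \<alpha>) T"
proof -
  obtain P :: "nat \<Rightarrow> 'a \<Rightarrow> real" where P: "graded_seminorms P"
    and complete: "\<forall>u. (\<forall>n. \<forall>\<epsilon>>0. \<exists>M. \<forall>i\<ge>M. \<forall>j\<ge>M. P n (u i - u j) < \<epsilon>) \<longrightarrow>
           (\<exists>l. \<forall>n. (\<lambda>i. P n (u i - l)) \<longlonglongrightarrow> 0)"
    by (rule frechet_graded_seminorms)
  obtain Q :: "nat \<Rightarrow> 'b \<Rightarrow> real" where Q: "graded_seminorms Q"
    by (rule frechet_graded_seminorms)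
  note P_semi = graded_seminormsD(1)[OF P] and Q_semi = graded_seminormsD(1)[OF Q]
  obtain y :: "nat \<Rightarrow> 'b" where y: "\<And>r. y r \<in> Y\<^sub>0"
    and y_dense: "\<And>U j. open U \<Longrightarrow> U \<noteq> {} \<Longrightarrow> \<exists>r\<ge>j. y r \<in> U"
    using separable_dense_sequence[OF Q sep dense] by metis

  (* The cross terms are controlled at stage p for all of y 0, ..., y p at once: the pair (p, r)
     is handled by the distance belonging to the larger of the two indices. *)
  define good where "good p M \<longleftrightarrow>
      (\<forall>F. finite F \<and> F \<subseteq> {1..} \<inter> {M..} \<longrightarrow> P p (\<Sum>n\<in>F. S n (y p)) < (1/4) ^ p) \<and>
      (\<forall>r\<in>{..p}. \<forall>k\<ge>1. \<forall>F. finite F \<and> F \<subseteq> {M..} \<longrightarrow>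
         Q p (\<Sum>n\<in>F. if n < k then T k (S (k - n) (y r)) else 0) < (1/4) ^ p) \<and>
      (\<forall>r\<in>{..p}. \<forall>k\<ge>1. \<forall>F. finite F \<and> F \<subseteq> {M..} \<longrightarrow>
         Q p (\<Sum>n\<in>F. T k (S (k + n) (y r))) < (1/4) ^ p)" for p M
  have "\<forall>\<^sub>F M in sequentially. good p M" for p
    unfolding good_def
    by (intro eventually_conj eventually_ball_finite ballI
        summable_on_eventually_small[OF P summable[OF y]]
        uniformly_unconditionally_summable_eventually_small[OF Q below[OF y]]
        uniformly_unconditionally_summable_eventually_small[OF Q above[OF y]]) auto
  moreover have "\<forall>\<^sub>F M in sequentially. T M (S M (y p)) \<in> {z. Q p (z - y p) < (1/2) ^ p}" for p
    by (rule topological_tendstoD[OF right_inverse[OF y] graded_seminorms_open_ball[OF Q]])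
      (simp add: seminorm_zero[OF Q_semi])
  ultimately have "\<exists>M. \<forall>M'\<ge>M. good p M' \<and> Q p (T M' (S M' (y p)) - y p) < (1/2) ^ p" for p
    using eventually_conj unfolding eventually_sequentially[symmetric] by fastforce
  then obtain N0 where N0: "\<And>p M. N0 p \<le> M \<Longrightarrow> good p M"
      "\<And>p M. N0 p \<le> M \<Longrightarrow> Q p (T M (S M (y p)) - y p) < (1/2) ^ p"
    by metis
  define N where "N p = Suc (\<Sum>i\<le>p. N0 i)" for p
  have "N0 p \<le> N p" for p
    using member_le_sum[of p "{..p}" N0] by (simp add: N_def)
  then have good: "good p (N p)"
    and at_self: "\<And>k. N p \<le> k \<Longrightarrow> Q p (T k (S k (y p)) - y p) < (1/2) ^ p" for p
    using N0 le_trans by blast+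
  have "mono N" "\<And>p. 1 \<le> N p"
    by (simp_all add: mono_iff_le_Suc N_def)
  then obtain E :: "nat \<Rightarrow> nat set" where E_ge: "\<And>p n. n \<in> E p \<Longrightarrow> N p \<le> n"
    and E_sep: "\<And>p q n m. n \<in> E p \<Longrightarrow> m \<in> E q \<Longrightarrow> p \<noteq> q \<or> n \<noteq> m \<Longrightarrow>
           n + N (max p q) \<le> m \<or> m + N (max p q) \<le> n"
    and E_density: "\<And>p E'. E p \<subseteq> E' \<Longrightarrow> 0 < lower_density (weight_matrix \<alpha>) E'"
    using separated_sets_of_positive_lower_density[OF pos ratio unbounded] by metis
  have E_pos: "1 \<le> n" if "n \<in> E p" for n p
    using E_ge[OF that] \<open>1 \<le> N p\<close> by simp

  have interaction: "Q p (\<Sum>m\<in>G. T k (S m (y r))) \<le> (1/2) ^ p * (2 * (1/2) ^ r)"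
    if k: "k \<in> E p" and fin: "finite G" and G: "G \<subseteq> E r - {k}" for p r k G
  proof -
    let ?M = "max p r" and ?G1 = "G \<inter> {..<k}" and ?G2 = "G \<inter> {k<..}"
    have far: "k + N ?M \<le> m \<or> m + N ?M \<le> k" if "m \<in> G" for m
      using E_sep[OF k, of m r] that G by auto
    have "1 \<le> k"
      using E_pos[OF k] .
    have "(\<Sum>m\<in>?G1. T k (S m (y r)))
        = (\<Sum>n\<in>(\<lambda>m. k - m) ` ?G1. if n < k then T k (S (k - n) (y r)) else 0)"
      using G E_pos[of _ r]
      by (intro sum.reindex_bij_witness[of _ "\<lambda>n. k - n" "\<lambda>m. k - m"]) force+
    moreover have "(\<lambda>m. k - m) ` ?G1 \<subseteq> {N ?M..}"
      using far by force
    ultimately have 1: "Q ?M (\<Sum>m\<in>?G1. T k (S m (y r))) < (1/4) ^ ?M"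
      using good[of ?M] \<open>1 \<le> k\<close> fin unfolding good_def by simp
    have "(\<Sum>m\<in>?G2. T k (S m (y r))) = (\<Sum>n\<in>(\<lambda>m. m - k) ` ?G2. T k (S (k + n) (y r)))"
      by (intro sum.reindex_bij_witness[of _ "\<lambda>n. k + n" "\<lambda>m. m - k"]) force+
    moreover have "(\<lambda>m. m - k) ` ?G2 \<subseteq> {N ?M..}"
      using far by force
    ultimately have 2: "Q ?M (\<Sum>m\<in>?G2. T k (S m (y r))) < (1/4) ^ ?M"
      using good[of ?M] \<open>1 \<le> k\<close> fin unfolding good_def by simp
    have "(\<Sum>m\<in>?G1 \<union> ?G2. T k (S m (y r)))
        = (\<Sum>m\<in>?G1. T k (S m (y r))) + (\<Sum>m\<in>?G2. T k (S m (y r)))"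
      using fin by (intro sum.union_disjoint) auto
    moreover have "?G1 \<union> ?G2 = G"
      using G by (auto simp: linorder_neq_iff)
    ultimately have "(\<Sum>m\<in>G. T k (S m (y r)))
        = (\<Sum>m\<in>?G1. T k (S m (y r))) + (\<Sum>m\<in>?G2. T k (S m (y r)))"
      by simp
    then have "Q ?M (\<Sum>m\<in>G. T k (S m (y r))) \<le> 2 * (1/4) ^ ?M"
      using seminorm_triangle[OF Q_semi, of ?M "\<Sum>m\<in>?G1. T k (S m (y r))"] 1 2 by smt
    moreover have "(1/4::real) ^ ?M \<le> (1/2) ^ (p + r)"
    proof -
      have "(1/4::real) ^ ?M = (1/2) ^ (2 * ?M)"
        by (simp add: power_mult power2_eq_square)
      also have "\<dots> \<le> (1/2) ^ (p + r)"
        by (rule power_decreasing) auto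
      finally show ?thesis .
    qed
    ultimately show ?thesis
      using graded_seminormsD(2)[OF Q, of p ?M "\<Sum>m\<in>G. T k (S m (y r))"]
      by (simp add: power_add)
  qed

  (* Truncating the double series at i in both indices gives finite sums. They are Cauchy: terms
     with large r are controlled by the choice of N, and for each of the finitely many other r
     by the convergence of the series of S m (y r). The weights (1/2) ^ r turn both
     into a single summable bound. *)
  define u where "u i = (\<Sum>r\<le>i. \<Sum>m\<in>E r \<inter> {..i}. S m (y r))" for i
  have cauchy: "\<exists>M. \<forall>i\<ge>M. \<forall>j\<ge>M. P n (u i - u j) < \<epsilon>" if "0 < \<epsilon>" for n \<epsilon>
  proof -
    define e where "e = \<epsilon> / 3"
    have "0 < e"
      using that by (simp add: e_def)
    obtain R0 where R0: "(1/2::real) ^ R0 < e"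
      using real_arch_pow_inv[OF \<open>0 < e\<close>, of "1/2"] by auto
    define R where "R = max R0 n"
    have "\<forall>\<^sub>F M in sequentially. \<forall>r\<in>{..R}.
        \<forall>F. finite F \<and> F \<subseteq> {1..} \<inter> {M..} \<longrightarrow> P n (\<Sum>m\<in>F. S m (y r)) < e * (1/2) ^ r"
      using \<open>0 < e\<close> by (intro eventually_ball_finite ballI
          summable_on_eventually_small[OF P summable[OF y]]) auto
    then obtain M0 where M0: "\<And>r F. r \<le> R \<Longrightarrow> finite F \<Longrightarrow> F \<subseteq> {1..} \<inter> {M0..} \<Longrightarrow>
        P n (\<Sum>m\<in>F. S m (y r)) < e * (1/2) ^ r"
      unfolding eventually_sequentially by (meson atMost_iff order_refl)
    have tail: "P n (\<Sum>m\<in>F. S m (y r)) \<le> e * (1/2) ^ r" if "R < r" "finite F" "F \<subseteq> E r" for r F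
    proof -
      have "F \<subseteq> {1..} \<inter> {N r..}"
        using that(3) E_ge E_pos by force
      then have "P r (\<Sum>m\<in>F. S m (y r)) < (1/4) ^ r"
        using good[of r] that(2) unfolding good_def by blast
      also have "(1/4::real) ^ r = (1/2) ^ r * (1/2) ^ r"
        by (simp add: power_mult_distrib[symmetric])
      also have "\<dots> \<le> e * (1/2) ^ r"
      proof (rule mult_right_mono)
        have "(1/2::real) ^ r \<le> (1/2) ^ R0"
          using that(1) by (intro power_decreasing) (auto simp: R_def)
        then show "(1/2::real) ^ r \<le> e"
          using R0 by linarith
      qed simp
      finally show ?thesis
        using graded_seminormsD(2)[OF P, of n r "\<Sum>m\<in>F. S m (y r)"] that(1) by (simp add: R_def)
    qed
    have main: "P n (u j - u i) < \<epsilon>" if ij: "i \<le> j" "max M0 R \<le> i" for i j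
    proof -
      define G where "G r = E r \<inter> {..j} - (if r \<le> i then {..i} else {})" for r
      have "u i = (\<Sum>r\<le>j. if r \<le> i then \<Sum>m\<in>E r \<inter> {..i}. S m (y r) else 0)"
        unfolding u_def using ij by (intro sum.mono_neutral_cong_left) auto
      moreover have "(\<Sum>m\<in>E r \<inter> {..j}. S m (y r))
          = (if r \<le> i then \<Sum>m\<in>E r \<inter> {..i}. S m (y r) else 0) + (\<Sum>m\<in>G r. S m (y r))" for r
      proof (cases "r \<le> i")
        case True
        then have "E r \<inter> {..j} = (E r \<inter> {..i}) \<union> G r" "(E r \<inter> {..i}) \<inter> G r = {}"
          using ij by (auto simp: G_def)
        moreover have "finite (G r)"
          by (simp add: G_def)
        ultimately show ?thesis
          using True sum.union_disjoint[of "E r \<inter> {..i}" "G r" "\<lambda>m. S m (y r)"] by simp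
      qed (simp add: G_def)
      ultimately have "u j - u i = (\<Sum>r\<le>j. \<Sum>m\<in>G r. S m (y r))"
        by (simp add: u_def sum.distrib)
      also have "P n \<dots> \<le> (\<Sum>r\<le>j. P n (\<Sum>m\<in>G r. S m (y r)))"
        by (rule seminorm_sum_le[OF P_semi])
      also have "\<dots> \<le> (\<Sum>r\<le>j. e * (1/2) ^ r)"
      proof (rule sum_mono)
        fix r
        show "P n (\<Sum>m\<in>G r. S m (y r)) \<le> e * (1/2) ^ r"
        proof (cases "r \<le> R")
          case True
          then have "G r \<subseteq> {1..} \<inter> {M0..}"
            using ij E_pos by (force simp: G_def)
          then show ?thesis
            using M0[OF True, of "G r"] by (simp add: G_def)
        next
          case False
          then show ?thesis
            by (intro tail) (auto simp: G_def)
        qed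
      qed
      also have "\<dots> \<le> e * 2"
        unfolding sum_distrib_left[symmetric]
        using \<open>0 < e\<close> by (intro mult_left_mono sum_half_powers_le) auto
      also have "\<dots> < \<epsilon>"
        using that \<open>0 < \<epsilon>\<close> by (simp add: e_def)
      finally show ?thesis .
    qed
    show ?thesis
    proof (intro exI[of _ "max M0 R"] allI impI)
      fix i j assume "max M0 R \<le> i" "max M0 R \<le> j"
      then show "P n (u i - u j) < \<epsilon>"
        using main[of i j] main[of j i] seminorm_minus_commute[OF P_semi, of n "u i" "u j"]
          nat_le_linear[of i j] by auto
    qed
  qed
  obtain x where x: "\<And>n. (\<lambda>i. P n (u i - x)) \<longlonglongrightarrow> 0"
    using complete cauchy by meson

  have approx: "Q p (T k x - y p) \<le> 6 * (1/2) ^ p" if k: "k \<in> E p" for p k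
  proof -
    have "1 \<le> k"
      using E_pos[OF k] .
    define V where "V = T k -` {z. Q p (z - T k x) < (1/2) ^ p}"
    have "open V"
      unfolding V_def by (intro open_vimage graded_seminorms_open_ball[OF Q] cont \<open>1 \<le> k\<close>)
    moreover have "x \<in> V"
      by (simp add: V_def seminorm_zero[OF Q_semi])
    ultimately obtain n \<epsilon> where "0 < \<epsilon>" and ball: "\<And>v. P n (v - x) < \<epsilon> \<Longrightarrow> v \<in> V"
      using graded_seminormsD(3)[OF P] by blast
    (* By continuity of T k it suffices to look at one truncation u i close to x. *)
    have "\<forall>\<^sub>F i in sequentially. P n (u i - x) < \<epsilon> \<and> max p k \<le> i"
      using order_tendstoD(2)[OF x \<open>0 < \<epsilon>\<close>] eventually_ge_at_top by (rule eventually_conj)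
    then obtain i where i: "P n (u i - x) < \<epsilon>" "p \<le> i" "k \<le> i"
      by (auto simp: eventually_sequentially)
    have Vi: "Q p (T k (u i) - T k x) < (1/2) ^ p"
      using ball[OF i(1)] by (simp add: V_def)
    let ?f = "\<lambda>r m. T k (S m (y r))"
    have "T k (u i) = (\<Sum>r\<le>i. \<Sum>m\<in>E r \<inter> {..i}. ?f r m)"
      by (simp add: u_def linear_sum[OF lin[OF \<open>1 \<le> k\<close>]])
    also have "\<dots> = (\<Sum>r\<le>i. (if r = p then ?f p k else 0) + (\<Sum>m\<in>E r \<inter> {..i} - {k}. ?f r m))"
    proof (rule sum.cong[OF refl])
      fix r
      show "(\<Sum>m\<in>E r \<inter> {..i}. ?f r m)
          = (if r = p then ?f p k else 0) + (\<Sum>m\<in>E r \<inter> {..i} - {k}. ?f r m)"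
      proof (cases "r = p")
        case True
        then show ?thesis
          using k i by (simp add: sum.remove[of _ k])
      next
        case False
        then have "k \<notin> E r"
          using E_sep[OF k, of k r] \<open>1 \<le> N (max p r)\<close> by auto
        then show ?thesis
          using False by simp
      qed
    qed
    also have "\<dots> = ?f p k + (\<Sum>r\<le>i. \<Sum>m\<in>E r \<inter> {..i} - {k}. ?f r m)"
      using i by (simp add: sum.distrib)
    finally have split: "T k (u i) - ?f p k = (\<Sum>r\<le>i. \<Sum>m\<in>E r \<inter> {..i} - {k}. ?f r m)"
      by simp
    have "Q p (T k (u i) - ?f p k) \<le> (\<Sum>r\<le>i. Q p (\<Sum>m\<in>E r \<inter> {..i} - {k}. ?f r m))"
      unfolding split by (rule seminorm_sum_le[OF Q_semi])
    also have "\<dots> \<le> (\<Sum>r\<le>i. (1/2) ^ p * (2 * (1/2) ^ r))"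
      by (intro sum_mono interaction[OF k]) auto
    also have "\<dots> = (1/2) ^ p * (2 * (\<Sum>r\<le>i. (1/2) ^ r))"
      by (simp only: sum_distrib_left)
    also have "\<dots> \<le> (1/2) ^ p * (2 * 2)"
      by (intro mult_left_mono sum_half_powers_le) auto
    finally have "Q p (T k (u i) - ?f p k) \<le> 4 * (1/2) ^ p"
      by simp
    moreover have "Q p (?f p k - y p) < (1/2) ^ p"
      by (rule at_self[OF E_ge[OF k]])
    moreover have "Q p (T k x - y p) \<le> Q p (T k x - T k (u i))
        + (Q p (T k (u i) - ?f p k) + Q p (?f p k - y p))"
      using seminorm_triangle_diff[OF Q_semi, of p "T k x" "y p" "T k (u i)"]
        seminorm_triangle_diff[OF Q_semi, of p "T k (u i)" "y p" "?f p k"] by linarith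
    ultimately show ?thesis
      using Vi seminorm_minus_commute[OF Q_semi, of p "T k x"] by simp
  qed

  show ?thesis
    unfolding frequently_universal_def
  proof (intro exI[of _ x] allI impI, elim conjE)
    fix U :: "'b set" assume U: "open U" "U \<noteq> {}"
    then obtain v where "v \<in> U" by blast
    then obtain n \<epsilon> where "0 < \<epsilon>" and ball: "\<And>z. Q n (z - v) < \<epsilon> \<Longrightarrow> z \<in> U"
      using graded_seminormsD(3)[OF Q U(1)] by blast
    obtain j where j: "(1/2::real) ^ j < \<epsilon> / 12"
      using real_arch_pow_inv[of "\<epsilon> / 12" "1/2"] \<open>0 < \<epsilon>\<close> by auto
    have "v \<in> {z. Q n (z - v) < \<epsilon> / 2}"
      using \<open>0 < \<epsilon>\<close> by (simp add: seminorm_zero[OF Q_semi])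
    then obtain p where p: "max n j \<le> p" "Q n (y p - v) < \<epsilon> / 2"
      using y_dense[OF graded_seminorms_open_ball[OF Q], of n v "\<epsilon> / 2" "max n j"] by blast
    have "E p \<subseteq> {k. 1 \<le> k \<and> T k x \<in> U}"
    proof safe
      fix k assume k: "k \<in> E p"
      then show "1 \<le> k"
        by (rule E_pos)
      have "Q n (T k x - y p) \<le> Q p (T k x - y p)"
        using p by (intro graded_seminormsD(2)[OF Q]) simp
      also have "\<dots> \<le> 6 * (1/2) ^ p"
        by (rule approx[OF k])
      also have "(1/2::real) ^ p \<le> (1/2) ^ j"
        using p by (intro power_decreasing) auto
      finally have "Q n (T k x - y p) < \<epsilon> / 2"
        using j by simp
      then show "T k x \<in> U"
        using p seminorm_triangle_diff[OF Q_semi, of n "T k x" v "y p"] by (intro ball) linarith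
    qed
    then show "0 < lower_density (weight_matrix \<alpha>) {k. 1 \<le> k \<and> T k x \<in> U}"
      by (rule E_density)
  qed
qed

theorem theorem3p9:
  fixes T :: "nat \<Rightarrow> 'a::frechet_space \<Rightarrow> 'b::frechet_space"
    and S :: "nat \<Rightarrow> 'b \<Rightarrow> 'a"
    and Y\<^sub>0 :: "'b set"
  assumes "separable_space (euclidean :: 'b topology)"
    and "\<And>n. 1 \<le> n \<Longrightarrow> linear (T n)"
    and "\<And>n. 1 \<le> n \<Longrightarrow> continuous_on UNIV (T n)"
    and "closure Y\<^sub>0 = UNIV"
    and "\<And>y. y \<in> Y\<^sub>0 \<Longrightarrow>
           uniformly_unconditionally_summable (\<lambda>k n. if n < k then T k (S (k - n) y) else 0)"
    and "\<And>y. y \<in> Y\<^sub>0 \<Longrightarrow>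
           uniformly_unconditionally_summable (\<lambda>k n. T k (S (k + n) y))"
    and "\<And>y. y \<in> Y\<^sub>0 \<Longrightarrow> (\<lambda>n. S n y) summable_on {1..}"
    and "\<And>y. y \<in> Y\<^sub>0 \<Longrightarrow> (\<lambda>n. T n (S n y)) \<longlonglongrightarrow> y"
  shows "\<forall>s\<ge>1. \<forall>\<alpha>. D_tilde_weights s \<alpha> \<longrightarrow> frequently_universal (weight_matrix \<alpha>) T"
proof (intro allI impI)
  fix s :: nat and \<alpha> assume s: "1 \<le> s" and D: "D_tilde_weights s \<alpha>"
  show "frequently_universal (weight_matrix \<alpha>) T"
  proof (rule frequent_universality_criterion_slowly_varying_weights[OF assms])
    show "0 < \<alpha> k" if "1 \<le> k" for k
      using D that by (simp add: D_tilde_weights_def)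
    show "(\<lambda>k. \<alpha> (Suc k) / \<alpha> k) \<longlonglongrightarrow> 1"
      by (rule D_tilde_weights_ratio[OF s D])
    show "filterlim (\<lambda>n. \<Sum>k=1..n. \<alpha> k) at_top sequentially"
      using D_tilde_weights_admissible[OF D] by (simp add: admissible_weights_def)
  qed
qed

end
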